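(* Assume (A1) $\mathbb{E}\log\rho_0=0$; (A2) there is $\delta_0\in(0,1)$ with $\mathbb{P}(\delta_0\le\omega(0)\le 1-\delta_0)=1$, and $\mathrm{Var}(\log\rho_0)>0$; (A3) the distribution of $\log\rho_0$ is concentrated on $\{kh:\ k\in\mathbb{Z}\}$ for some $h>0$. Let $f:\{-1,1\}\to\mathbb{R}$ and $\Delta X_k=X_{k+1}-X_k$, $k\in\mathbb{N}$. Then $$\frac1n\sum_{k=1}^n f(\Delta X_k)\ \longrightarrow\ \frac{f(1)+f(-1)}{2}\qquad(n\to\infty)$$ in probability under the annealed law $\mathbf{P}$. In particular, $X_n/n\to0$ in $\mathbf{P}$-probability as $n\to\infty$.
   Context: $\Omega=[0,1]^{\mathbb{Z}}$; $\omega=(\omega(x))_{x\in\mathbb{Z}}$ is a family of i.i.d. $[0,1]$-valued random variables with law $\mathbb{P}$ on $\Omega$ and expectation $\mathbb{E}$; $\rho_x=\frac{1-\omega(x)}{\omega(x)}$. Given $\omega$, $X=(X_k)_{k\ge0}$ is the Markov chain on $\mathbb{Z}_+=\{0,1,2,\dots\}$ started at $0$, reflected at $0$, with transitions $p^\omega(0,1)=1$ and, for $x\ge1$, $p^\omega(x,x+1)=\omega(x)$, $p^\omega(x,x-1)=1-\omega(x)$; its (quenched) law is $P_0^\omega$. The annealed law is $\mathbf{P}(F\times G)=\int_F P_0^\omega(G)\,\mathbb{P}(d\omega)$, the law of $(\omega,X)$. *)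

theory Defs
  imports "HOL-Probability.Probability"
begin

section \<open>Path law of a Markov chain on the non-negative integers\<close>

definition path_space :: "(nat \<Rightarrow> nat) measure" where
  "path_space = PiM UNIV (\<lambda>_. count_space UNIV)"

lemma space_path_space [simp]: "space path_space = UNIV"
  by (simp add: path_space_def space_PiM)

lemma measurable_path_coord [measurable]: "(\<lambda>X. X k) \<in> path_space \<rightarrow>\<^sub>M count_space UNIV"
  unfolding path_space_def by (rule measurable_component_singleton) simp

definition chain_kernel ::
  "(nat \<Rightarrow> nat pmf) \<Rightarrow> nat \<Rightarrow> nat \<Rightarrow> (nat \<Rightarrow> nat) \<Rightarrow> nat measure" where
  "chain_kernel p s n X = measure_pmf (case n of 0 \<Rightarrow> return_pmf s | Suc m \<Rightarrow> p (X m))"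

lemma Ionescu_Tulcea_chain_kernel:
  "Ionescu_Tulcea (chain_kernel p s) (\<lambda>_. count_space UNIV)"
proof (rule Ionescu_Tulcea.intro)
  fix n :: nat
  show "chain_kernel p s n \<in> PiM {0..<n} (\<lambda>_. count_space UNIV) \<rightarrow>\<^sub>M subprob_algebra (count_space UNIV)"
  proof (cases n)
    case 0
    then show ?thesis
      by (auto simp: chain_kernel_def [abs_def] space_subprob_algebra
          intro!: measurable_const measure_pmf.subprob_space_axioms)
  next
    case (Suc m)
    have 1: "(\<lambda>i. measure_pmf (p i)) \<in> count_space UNIV \<rightarrow>\<^sub>M subprob_algebra (count_space UNIV)"
      by (auto simp: space_subprob_algebra intro!: measure_pmf.subprob_space_axioms)
    have 2: "(\<lambda>X. X m) \<in> PiM {0..<n} (\<lambda>_. count_space UNIV) \<rightarrow>\<^sub>M count_space UNIV"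
      by (rule measurable_component_singleton) (simp add: Suc)
    show ?thesis
      using measurable_compose [OF 2 1] by (simp add: Suc chain_kernel_def [abs_def])
  qed
next
  fix n :: nat and X assume "X \<in> space (PiM {0..<n} (\<lambda>_. count_space UNIV) :: (nat \<Rightarrow> nat) measure)"
  show "prob_space (chain_kernel p s n X)"
    unfolding chain_kernel_def by (rule measure_pmf.prob_space_axioms)
qed

interpretation chain: Ionescu_Tulcea "chain_kernel p s" "\<lambda>_. count_space UNIV" for p s
  by (rule Ionescu_Tulcea_chain_kernel)

text \<open>
  The law of the chain with transition probabilities \<open>p\<close> started at \<open>s\<close>, obtained from the
  Ionescu Tulcea theorem; \<open>emeasure_chain_cylinder\<close> below gives its finite-dimensional distributions.
\<close>

definition chain_law :: "(nat \<Rightarrow> nat pmf) \<Rightarrow> nat \<Rightarrow> (nat \<Rightarrow> nat) measure" where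
  "chain_law p s =
    projective_family.lim UNIV (Ionescu_Tulcea.CI (chain_kernel p s) (\<lambda>_. count_space UNIV))
      (\<lambda>_. count_space UNIV)"

lemma sets_chain_law [simp, measurable_cong]: "sets (chain_law p s) = sets path_space"
  by (simp add: chain_law_def path_space_def)

lemma space_chain_law [simp]: "space (chain_law p s) = UNIV"
  using sets_eq_imp_space_eq [OF sets_chain_law, of p s] by simp

definition cylinder :: "nat list \<Rightarrow> (nat \<Rightarrow> nat) set" where
  "cylinder l = {X. \<forall>i < length l. X i = l ! i}"

definition path_prob :: "(nat \<Rightarrow> nat pmf) \<Rightarrow> nat \<Rightarrow> nat list \<Rightarrow> real" where
  "path_prob p s l = (if l = [] then 1 else if hd l \<noteq> s then 0
     else (\<Prod>i < length l - 1. pmf (p (l ! i)) (l ! Suc i)))"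

lemma path_prob_snoc:
  "path_prob p s (l @ [y]) =
     path_prob p s l * (if l = [] then indicator {s} y else pmf (p (last l)) y)"
proof (cases l rule: rev_cases)
  case Nil
  then show ?thesis by (auto simp: path_prob_def)
next
  case (snoc m z)
  have eq: "(\<Prod>i < length m. pmf (p ((m @ [z, y]) ! i)) ((m @ [z, y]) ! Suc i)) =
        (\<Prod>i < length m. pmf (p ((m @ [z]) ! i)) ((m @ [z]) ! Suc i))"
  proof (rule prod.cong)
    fix i assume i: "i \<in> {..<length m}"
    have "(m @ [z, y]) ! j = (m @ [z]) ! j" if "j \<le> length m" for j
      using that by (auto simp: nth_append nth_Cons split: nat.splits)
    with i show "pmf (p ((m @ [z, y]) ! i)) ((m @ [z, y]) ! Suc i) =
        pmf (p ((m @ [z]) ! i)) ((m @ [z]) ! Suc i)" by simp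
  qed simp
  have "hd (m @ [z, y]) = hd (m @ [z])" by (cases m) auto
  moreover have "(m @ [z, y]) ! Suc (length m) = y" "(m @ [z, y]) ! length m = z"
    by (auto simp: nth_append)
  ultimately show ?thesis
    by (simp add: snoc path_prob_def eq)
qed

lemma path_prob_nonneg: "0 \<le> path_prob p s l"
  by (auto simp: path_prob_def intro!: prod_nonneg)

lemma sets_singleton_chain:
  assumes "finite J" "x \<in> extensional J"
  shows "{x} \<in> sets (PiM J (\<lambda>_::nat. count_space (UNIV :: nat set)))"
proof -
  have "{x} = (\<Pi>\<^sub>E i\<in>J. {x i})"
    using assms(2) by (auto simp: PiE_iff intro: extensionalityI extensional_arb)
  then show ?thesis using assms(1) by (auto intro!: sets_PiM_I_finite)
qed

lemma emeasure_chain_C: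
  "emeasure (chain.C p s 0 (length l) (\<lambda>_. undefined)) {restrict ((!) l) {0..<length l}} =
     ennreal (path_prob p s l)"
proof (induction l rule: rev_induct)
  case Nil
  show ?case
    by (simp add: path_prob_def restrict_def space_PiM PiE_empty_domain sets_singleton_chain)
next
  case (snoc y l)
  let ?n = "length l" and ?M = "\<lambda>_::nat. count_space (UNIV :: nat set)"
  let ?x = "restrict ((!) l) {0..<?n}"
  let ?x' = "restrict ((!) (l @ [y])) {0..<Suc ?n}"
  have u: "(\<lambda>_. undefined) \<in> space (PiM {0..<0} ?M)" by (simp add: space_PiM)
  have x'[measurable]: "{?x'} \<in> sets (PiM {0..<Suc ?n} ?M)"
    by (rule sets_singleton_chain) auto
  have x[measurable]: "{?x} \<in> sets (PiM {0..<?n} ?M)"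
    by (rule sets_singleton_chain) auto
  have spC: "space (chain.C p s 0 ?n (\<lambda>_. undefined)) = space (PiM {0..<?n} ?M)"
    using chain.space_C [OF u, of p s ?n] by simp
  have seC: "sets (chain.C p s 0 ?n (\<lambda>_. undefined)) = sets (PiM {0..<?n} ?M)"
    using chain.sets_C [OF u, of p s ?n] by simp
  have ne: "space (chain.C p s 0 ?n (\<lambda>_. undefined)) \<noteq> {}"
    using chain.prob_space_C [OF u, of p s ?n] by (rule prob_space.not_empty)
  have meas: "chain.eP p s ?n \<in> chain.C p s 0 ?n (\<lambda>_. undefined) \<rightarrow>\<^sub>M
      subprob_algebra (PiM {0..<Suc ?n} ?M)"
    using chain.measurable_eP [of p s ?n] by (simp add: measurable_cong_sets [OF seC refl])
  let ?c = "if l = [] then indicator {s} y else pmf (p (last l)) y"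
  have step: "emeasure (chain.eP p s ?n X) {?x'} = ennreal ?c * indicator {?x} X"
    if X: "X \<in> space (PiM {0..<?n} ?M)" for X
  proof -
    have Xext: "X \<in> extensional {0..<?n}" using X by (auto simp: space_PiM PiE_iff)
    have vim: "(\<lambda>v. X(?n := v)) -` {?x'} = (if X = ?x then {y} else {})"
    proof -
      have "X(?n := v) = ?x' \<longleftrightarrow> X = ?x \<and> v = y" for v
      proof
        assume eq: "X(?n := v) = ?x'"
        have "v = y" using fun_cong [OF eq, of ?n] by simp
        moreover have "X = ?x"
        proof (rule extensionalityI [OF Xext])
          fix i assume "i \<in> {0..<?n}"
          then show "X i = ?x i"
            using fun_cong [OF eq, of i] by (simp add: nth_append)
        qed simp
        ultimately show "X = ?x \<and> v = y" by simp
      next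
        assume "X = ?x \<and> v = y"
        then show "X(?n := v) = ?x'"
          by (intro ext) (simp add: nth_append)
      qed
      then show ?thesis
        by (intro set_eqI) (simp only: vimage_eq singleton_iff, simp)
    qed
    have "chain_kernel p s ?n ?x = measure_pmf (if l = [] then return_pmf s else p (last l))"
      by (cases l rule: rev_cases) (auto simp: chain_kernel_def)
    then have "X = ?x \<Longrightarrow> emeasure (chain_kernel p s ?n X) {y} = ennreal ?c"
      by (auto simp: emeasure_pmf_single pmf_return indicator_def)
    then show ?thesis
      by (subst chain.emeasure_eP [OF X x']) (simp add: vim)
  qed
  have "emeasure (chain.C p s 0 (Suc ?n) (\<lambda>_. undefined)) {?x'} =
     (\<integral>\<^sup>+X. emeasure (chain.eP p s ?n X) {?x'} \<partial>chain.C p s 0 ?n (\<lambda>_. undefined))"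
    using emeasure_bind [OF ne meas x'] by simp
  also have "\<dots> = (\<integral>\<^sup>+X. ennreal ?c * indicator {?x} X \<partial>chain.C p s 0 ?n (\<lambda>_. undefined))"
    by (intro nn_integral_cong step) (simp add: spC)
  also have "\<dots> = ennreal ?c * emeasure (chain.C p s 0 ?n (\<lambda>_. undefined)) {?x}"
    by (rule nn_integral_cmult_indicator) (simp add: seC x)
  also have "\<dots> = ennreal (path_prob p s (l @ [y]))"
    by (simp add: snoc path_prob_snoc ennreal_mult' path_prob_nonneg mult.commute)
  finally show ?case by (simp only: length_append_singleton)
qed

lemma cylinder_eq_emb:
  "cylinder l = prod_emb UNIV (\<lambda>_. count_space UNIV) {0..<length l} {restrict ((!) l) {0..<length l}}"
proof -
  have "restrict X {0..<length l} = restrict ((!) l) {0..<length l} \<longleftrightarrow>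
      (\<forall>i < length l. X i = l ! i)" for X
    by (metis atLeastLessThan_iff le0 restrict_apply' restrict_ext)
  then show ?thesis
    by (auto simp: cylinder_def prod_emb_def)
qed

lemma sets_cylinder [measurable]: "cylinder l \<in> sets path_space"
  unfolding cylinder_eq_emb path_space_def
  by (intro measurable_prod_emb sets_singleton_chain) auto

lemma emeasure_chain_cylinder:
  "emeasure (chain_law p s) (cylinder l) = ennreal (path_prob p s l)"
proof -
  have "{restrict ((!) l) {0..<length l}} \<in> sets (PiM {0..<length l} (\<lambda>_. count_space UNIV))"
    by (rule sets_singleton_chain) auto
  then show ?thesis
    unfolding cylinder_eq_emb chain_law_def
    by (simp add: chain.lim chain.emeasure_CI [where n = "length l"] emeasure_chain_C prod_emb_id)
qed

lemma prob_space_chain_law: "prob_space (chain_law p s)"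
proof
  have "cylinder [] = UNIV" by (simp add: cylinder_def)
  then show "emeasure (chain_law p s) (space (chain_law p s)) = 1"
    using emeasure_chain_cylinder [of p s "[]"] by (simp add: path_prob_def)
qed

lemma sets_path_space_cylinder:
  "sets path_space = sigma_sets UNIV (insert {} (range cylinder))"
proof
  have "{f \<in> \<Pi>\<^sub>E i\<in>UNIV. UNIV. f i \<in> A} \<in> sigma_sets UNIV (insert {} (range cylinder))"
    for i :: nat and A :: "nat set"
  proof -
    have "{f \<in> \<Pi>\<^sub>E i\<in>UNIV. UNIV. f i \<in> A} =
        (\<Union>l\<in>{l. length l = Suc i \<and> last l \<in> A}. cylinder l)"
    proof (intro set_eqI iffI)
      fix f :: "nat \<Rightarrow> nat" assume "f \<in> {f \<in> \<Pi>\<^sub>E i\<in>UNIV. UNIV. f i \<in> A}"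
      then have "map f [0..<Suc i] \<in> {l. length l = Suc i \<and> last l \<in> A}"
        "f \<in> cylinder (map f [0..<Suc i])"
        by (auto simp: cylinder_def simp del: upt_Suc simp add: last_map)
      then show "f \<in> (\<Union>l\<in>{l. length l = Suc i \<and> last l \<in> A}. cylinder l)" by blast
    next
      fix f assume "f \<in> (\<Union>l\<in>{l. length l = Suc i \<and> last l \<in> A}. cylinder l)"
      then obtain l where l: "length l = Suc i" "last l \<in> A" "f \<in> cylinder l" by blast
      then have "last l = l ! i" by (subst last_conv_nth) auto
      with l show "f \<in> {f \<in> \<Pi>\<^sub>E i\<in>UNIV. UNIV. f i \<in> A}" by (auto simp: cylinder_def)
    qed
    also have "\<dots> \<in> sigma_sets UNIV (insert {} (range cylinder))"
      by (rule sigma_sets_UNION) (auto intro!: countable_image sigma_sets.Basic)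
    finally show ?thesis .
  qed
  then show "sets path_space \<subseteq> sigma_sets UNIV (insert {} (range cylinder))"
    unfolding path_space_def sets_PiM_single
    by (simp add: space_PiM, intro sigma_sets_mono) auto
  show "sigma_sets UNIV (insert {} (range cylinder)) \<subseteq> sets path_space"
    using sets.sigma_sets_subset [of "insert {} (range cylinder)" path_space] sets_cylinder
    by (simp add: image_subset_iff)
qed

lemma Int_stable_cylinder: "Int_stable (insert {} (range cylinder))"
proof -
  have "cylinder l \<inter> cylinder m \<in> insert {} (range cylinder)" if le: "length l \<le> length m" for l m
  proof (cases "\<forall>i<length l. l ! i = m ! i")
    case True
    then have "cylinder l \<inter> cylinder m = cylinder m"
      using le by (auto simp: cylinder_def)
    then show ?thesis by auto
  next
    case False
    then obtain i where i: "i < length l" "l ! i \<noteq> m ! i" by auto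
    have "X \<notin> cylinder l \<inter> cylinder m" for X
    proof
      assume "X \<in> cylinder l \<inter> cylinder m"
      then have "X i = l ! i" "X i = m ! i" using i le by (auto simp: cylinder_def)
      with i show False by simp
    qed
    then show ?thesis by auto
  qed
  then have "cylinder l \<inter> cylinder m \<in> insert {} (range cylinder)" for l m
    by (metis nle_le Int_commute)
  then show ?thesis by (auto simp: Int_stable_def)
qed

section \<open>Random environment, quenched and annealed laws\<close>

type_synonym env = "int \<Rightarrow> real"

abbreviation unit_interval :: "real measure" where
  "unit_interval \<equiv> restrict_space borel {0..1}"

definition env_space :: "env measure" where
  "env_space = PiM UNIV (\<lambda>_. unit_interval)"

definition iid_env :: "env measure \<Rightarrow> bool" where
  "iid_env P \<longleftrightarrow> prob_space P \<and> sets P = sets env_space \<and>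
     prob_space.indep_vars P (\<lambda>_. unit_interval) (\<lambda>x \<omega>. \<omega> x) UNIV \<and>
     (\<forall>x. distr P unit_interval (\<lambda>\<omega>. \<omega> x) = distr P unit_interval (\<lambda>\<omega>. \<omega> 0))"

definition rho :: "env \<Rightarrow> int \<Rightarrow> real" where
  "rho \<omega> x = (1 - \<omega> x) / \<omega> x"

text \<open>
  The quenched transition probabilities. \<^const>\<open>bernoulli_pmf\<close> truncates its parameter to
  \<open>[0, 1]\<close>, which has no effect on \<^term>\<open>space env_space\<close>; see \<open>pmf_step\<close> below.
\<close>

definition step :: "env \<Rightarrow> nat \<Rightarrow> nat pmf" where
  "step \<omega> x = (if x = 0 then return_pmf 1
     else map_pmf (\<lambda>b. if b then x + 1 else x - 1) (bernoulli_pmf (\<omega> (int x))))"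

definition quenched :: "env \<Rightarrow> (nat \<Rightarrow> nat) measure" where
  "quenched \<omega> = chain_law (step \<omega>) 0"

text \<open>The joint law of environment and walk; see \<open>emeasure_annealed_Times\<close>.\<close>

definition annealed :: "env measure \<Rightarrow> (env \<times> (nat \<Rightarrow> nat)) measure" where
  "annealed P = P \<bind> (\<lambda>\<omega>. quenched \<omega> \<bind> (\<lambda>X. return (env_space \<Otimes>\<^sub>M path_space) (\<omega>, X)))"

lemma env_space_in_unit: "\<omega> \<in> space env_space \<Longrightarrow> 0 \<le> \<omega> x \<and> \<omega> x \<le> 1"
  by (auto simp: env_space_def space_PiM PiE_iff space_restrict_space)

lemma measurable_env_coord [measurable]: "(\<lambda>\<omega>. \<omega> x) \<in> env_space \<rightarrow>\<^sub>M borel"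
proof -
  have "(\<lambda>\<omega>. \<omega> x) \<in> env_space \<rightarrow>\<^sub>M unit_interval"
    unfolding env_space_def by (rule measurable_component_singleton) simp
  then show ?thesis by (simp add: measurable_restrict_space2_iff)
qed

lemma pmf_step:
  assumes "0 \<le> \<omega> (int x)" "\<omega> (int x) \<le> 1"
  shows "pmf (step \<omega> x) y =
    (if x = 0 then of_bool (y = 1)
     else if y = x + 1 then \<omega> (int x) else if y + 1 = x then 1 - \<omega> (int x) else 0)"
proof (cases "x = 0")
  case True
  then show ?thesis by (simp add: step_def pmf_return indicator_def)
next
  case False
  then have "(\<lambda>b. if b then x + 1 else x - 1) -` {y} =
     (if y = x + 1 then {True} else if y + 1 = x then {False} else {})"
    by (auto split: if_splits)
  with False assms show ?thesis
    by (simp add: step_def pmf_map measure_pmf_single)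
qed

lemma measurable_quenched: "quenched \<in> env_space \<rightarrow>\<^sub>M prob_algebra path_space"
proof (rule measurable_prob_algebra_generated [OF sets_path_space_cylinder Int_stable_cylinder])
  fix A assume A: "A \<in> insert {} (range cylinder)"
  have pm: "(\<lambda>\<omega>. pmf (step \<omega> x) y) \<in> borel_measurable env_space" for x y
    by (subst measurable_cong [OF pmf_step]) (auto dest: env_space_in_unit)
  have "(\<lambda>\<omega>. path_prob (step \<omega>) 0 l) \<in> borel_measurable env_space" for l
    unfolding path_prob_def using pm by simp
  with A show "(\<lambda>\<omega>. emeasure (quenched \<omega>) A) \<in> borel_measurable env_space"
    by (auto simp: quenched_def emeasure_chain_cylinder)
qed (auto simp: quenched_def prob_space_chain_law)

lemma
  assumes "prob_space P" and sP: "sets P = sets env_space"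
  shows prob_space_annealed: "prob_space (annealed P)"
    and sets_annealed: "sets (annealed P) = sets (env_space \<Otimes>\<^sub>M path_space)"
    and emeasure_annealed_Times: "\<And>F G. F \<in> sets env_space \<Longrightarrow> G \<in> sets path_space \<Longrightarrow>
      emeasure (annealed P) (F \<times> G) = (\<integral>\<^sup>+\<omega>\<in>F. emeasure (quenched \<omega>) G \<partial>P)"
proof -
  let ?K = "\<lambda>\<omega>. quenched \<omega> \<bind> (\<lambda>X. return (env_space \<Otimes>\<^sub>M path_space) (\<omega>, X))"
  note measurable_quenched [measurable]
  have K: "?K \<in> env_space \<rightarrow>\<^sub>M prob_algebra (env_space \<Otimes>\<^sub>M path_space)"
    by measurable
  have P: "P \<in> space (prob_algebra env_space)" using assms by (simp add: space_prob_algebra)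
  show "prob_space (annealed P)" "sets (annealed P) = sets (env_space \<Otimes>\<^sub>M path_space)"
    unfolding annealed_def using prob_space_bind' [OF P K] sets_bind' [OF P K] by auto
  fix F G assume FG [measurable]: "F \<in> sets env_space" "G \<in> sets path_space"
  have "emeasure (annealed P) (F \<times> G) = (\<integral>\<^sup>+\<omega>. emeasure (?K \<omega>) (F \<times> G) \<partial>P)"
    unfolding annealed_def by (rule emeasure_bind_prob_algebra [OF P K]) simp
  also have "\<dots> = (\<integral>\<^sup>+\<omega>\<in>F. emeasure (quenched \<omega>) G \<partial>P)"
  proof (rule nn_integral_cong)
    fix \<omega> assume "\<omega> \<in> space P"
    then have \<omega>: "\<omega> \<in> space env_space" using sets_eq_imp_space_eq [OF sP] by simp
    have q: "quenched \<omega> \<in> space (prob_algebra path_space)"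
      by (rule measurable_space [OF measurable_quenched \<omega>])
    have r: "(\<lambda>X. return (env_space \<Otimes>\<^sub>M path_space) (\<omega>, X)) \<in>
        path_space \<rightarrow>\<^sub>M prob_algebra (env_space \<Otimes>\<^sub>M path_space)"
      using \<omega> by measurable
    have "emeasure (?K \<omega>) (F \<times> G) =
       (\<integral>\<^sup>+X. emeasure (return (env_space \<Otimes>\<^sub>M path_space) (\<omega>, X)) (F \<times> G) \<partial>quenched \<omega>)"
      by (rule emeasure_bind_prob_algebra [OF q r]) simp
    also have "\<dots> = (\<integral>\<^sup>+X. indicator F \<omega> * indicator G X \<partial>quenched \<omega>)"
      by (intro nn_integral_cong) (simp add: indicator_times)
    also have "\<dots> = indicator F \<omega> * emeasure (quenched \<omega>) G"
      by (rule nn_integral_cmult_indicator) (simp add: quenched_def)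
    finally show "emeasure (?K \<omega>) (F \<times> G) = emeasure (quenched \<omega>) G * indicator F \<omega>"
      by (simp add: mult.commute)
  qed
  finally show "emeasure (annealed P) (F \<times> G) = (\<integral>\<^sup>+\<omega>\<in>F. emeasure (quenched \<omega>) G \<partial>P)" .
qed

section \<open>Convergence in probability\<close>

definition tendsto_in_prob :: "'a measure \<Rightarrow> (nat \<Rightarrow> 'a \<Rightarrow> real) \<Rightarrow> real \<Rightarrow> bool" where
  "tendsto_in_prob M Y c \<longleftrightarrow> (\<forall>n. Y n \<in> borel_measurable M) \<and>
     (\<forall>\<epsilon>>0. (\<lambda>n. measure M {z \<in> space M. \<epsilon> < \<bar>Y n z - c\<bar>}) \<longlonglongrightarrow> 0)"

definition increment :: "(nat \<Rightarrow> nat) \<Rightarrow> nat \<Rightarrow> int" where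
  "increment X k = int (X (Suc k)) - int (X k)"

end

theory Submission
  imports Defs "HOL-Real_Asymp.Real_Asymp"
begin

text \<open>
  On \<open>{-1, 1}\<close> every function agrees with an affine one, so the average of \<open>f\<close> over the increments differs from
  \<open>(f 1 + f (-1)) / 2\<close> by a multiple of \<open>(X (n + 1) - X 1) / n\<close> (\<open>sum_fun_increments\<close>). Everything
  therefore follows from the vanishing of the speed, \<open>X n / n \<rightarrow> 0\<close> in annealed probability.

  The speed vanishes because the potential \<open>V x = (\<Sum>i\<in>{1..<x}. ln (rho \<omega> i))\<close> fluctuates. Given the
  environment, the walk is reversible with respect to a measure comparable to \<open>exp (- V)\<close>, and a
  reversible chain reaches \<open>y\<close> from \<open>x\<close> at a given time with probability at most the ratio of the
  weights of \<open>y\<close> and \<open>x\<close> (\<open>excessive_measure_bound\<close>). Summing over the times of the visits to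
  \<open>x\<close> and \<open>y\<close>, a walk which gets beyond \<open>y\<close> by time \<open>n\<close> has quenched probability at most a
  constant times \<open>(n + 1)\<^sup>2 * exp (- (V y - V x))\<close> for all \<open>1 \<le> x < y\<close> (\<open>quenched_prob_ge_le\<close>).
  A barrier in the potential that is much higher than \<open>ln n\<close> thus stops the walk until time \<open>n\<close>.

  It remains to find such a barrier among the first \<open>\<epsilon> n\<close> sites. As \<open>V\<close> is a centred random walk with
  positive finite variance, its increment over a block of length \<open>r\<close> exceeds a multiple of \<open>sqrt r\<close> with
  probability bounded away from \<open>0\<close>, by the central limit theorem. Among \<open>k\<close> disjoint blocks of
  length about \<open>\<epsilon> n / k\<close>, which are independent, at least one provides a barrier of order \<open>sqrt n\<close>, except
  on an event whose probability is small uniformly in large \<open>n\<close> once \<open>k\<close> is large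
  (\<open>annealed_speed_zero\<close>). Uniform ellipticity, \<open>\<delta> \<le> \<omega> x \<le> 1 - \<delta>\<close>, keeps the invariant measure
  comparable to \<open>exp (- V)\<close> and gives \<open>V\<close> bounded steps.
\<close>

section \<open>Markov chains with an excessive measure\<close>

lemma mem_cylinder_iff: "X \<in> cylinder l \<longleftrightarrow> map X [0..<length l] = l"
proof
  assume "X \<in> cylinder l"
  then show "map X [0..<length l] = l"
    by (intro nth_equalityI) (auto simp: cylinder_def)
next
  assume l: "map X [0..<length l] = l"
  have "X i = l ! i" if "i < length l" for i
    using that arg_cong[OF l, of "\<lambda>l. l ! i"] by simp
  then show "X \<in> cylinder l" by (simp add: cylinder_def)
qed

text \<open>
  The Markov property at time \<open>k\<close>: the condition \<open>Q\<close> stands for an arbitrary event of the past.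
  Such an event is a countable disjoint union of cylinders, so the claim reduces to the product
  form of the cylinder probabilities.
\<close>

lemma emeasure_chain_step:
  "emeasure (chain_law p s) {X. Q (map X [0..<Suc k]) \<and> X k = w \<and> X (Suc k) = z} =
   emeasure (chain_law p s) {X. Q (map X [0..<Suc k]) \<and> X k = w} * ennreal (pmf (p w) z)"
proof -
  let ?M = "chain_law p s"
  define A where "A = {l. length l = Suc k \<and> Q l \<and> last l = w}"
  have len: "length l = Suc k" if "l \<in> A" for l
    using that by (simp add: A_def)
  have cyl: "X \<in> cylinder l \<longleftrightarrow> l = map X [0..<Suc k]" if "l \<in> A" for X l
    unfolding mem_cylinder_iff len[OF that] by (rule eq_commute)
  have cyl': "X \<in> cylinder (l @ [z]) \<longleftrightarrow> l = map X [0..<Suc k] \<and> X (Suc k) = z" if "l \<in> A" for X l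
    using upt_Suc_append[of 0 "Suc k"]
    by (simp add: mem_cylinder_iff len[OF that] eq_commute[of l] del: upt_Suc)
  have A: "map X [0..<Suc k] \<in> A \<longleftrightarrow> Q (map X [0..<Suc k]) \<and> X k = w" for X
    by (simp add: A_def)
  have Q: "{X. Q (map X [0..<Suc k]) \<and> X k = w} = (\<Union>l\<in>A. cylinder l)"
    (is "?L = ?R")
  proof (intro set_eqI iffI)
    fix X assume "X \<in> ?L"
    then have "map X [0..<Suc k] \<in> A" using A[of X] by (simp del: upt_Suc)
    then show "X \<in> ?R" using cyl[of _ X] by (intro UN_I[of "map X [0..<Suc k]"]) (simp_all only: )
  next
    fix X assume "X \<in> ?R"
    then obtain l where l: "l \<in> A" "X \<in> cylinder l" by blast
    then have "map X [0..<Suc k] \<in> A" using cyl[OF l(1)] by (simp only:)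
    then show "X \<in> ?L" using A[of X] by (simp del: upt_Suc)
  qed
  have disj: "disjoint_family_on cylinder A"
  proof (unfold disjoint_family_on_def disjoint_iff, intro ballI allI impI notI)
    fix l m X assume "l \<in> A" "m \<in> A" "l \<noteq> m" "X \<in> cylinder l" "X \<in> cylinder m"
    then show False using cyl[of l X] cyl[of m X] by (simp only:)
  qed
  have 1: "emeasure ?M {X. Q (map X [0..<Suc k]) \<and> X k = w} =
      (\<integral>\<^sup>+l. emeasure ?M (cylinder l) \<partial>count_space A)"
    unfolding Q by (rule emeasure_UN_countable[OF _ _ disj]) simp_all
  have Q': "{X. Q (map X [0..<Suc k]) \<and> X k = w \<and> X (Suc k) = z} = (\<Union>l\<in>A. cylinder (l @ [z]))"
    (is "?L = ?R")
  proof (intro set_eqI iffI)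
    fix X assume "X \<in> ?L"
    then have "map X [0..<Suc k] \<in> A" "X (Suc k) = z" using A[of X] by (simp_all del: upt_Suc)
    then show "X \<in> ?R" using cyl'[of _ X] by (intro UN_I[of "map X [0..<Suc k]"]) (simp_all only: simp_thms)
  next
    fix X assume "X \<in> ?R"
    then obtain l where l: "l \<in> A" "X \<in> cylinder (l @ [z])" by blast
    then have "map X [0..<Suc k] \<in> A \<and> X (Suc k) = z" using cyl'[OF l(1), of X] by (simp only:)
    then show "X \<in> ?L" using A[of X] by (simp del: upt_Suc)
  qed
  have disj': "disjoint_family_on (\<lambda>l. cylinder (l @ [z])) A"
  proof (unfold disjoint_family_on_def disjoint_iff, intro ballI allI impI notI)
    fix l m X assume "l \<in> A" "m \<in> A" "l \<noteq> m" "X \<in> cylinder (l @ [z])" "X \<in> cylinder (m @ [z])"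
    then show False using cyl'[of l X] cyl'[of m X] by (simp only:)
  qed
  have "emeasure ?M {X. Q (map X [0..<Suc k]) \<and> X k = w \<and> X (Suc k) = z} =
      (\<integral>\<^sup>+l. emeasure ?M (cylinder (l @ [z])) \<partial>count_space A)"
    unfolding Q' by (rule emeasure_UN_countable[OF _ _ disj']) simp_all
  also have "\<dots> = (\<integral>\<^sup>+l. emeasure ?M (cylinder l) * ennreal (pmf (p w) z) \<partial>count_space A)"
  proof (intro nn_integral_cong)
    fix l assume "l \<in> space (count_space A)"
    then have "l \<noteq> []" "last l = w" by (auto simp: A_def)
    then show "emeasure ?M (cylinder (l @ [z])) =
        emeasure ?M (cylinder l) * ennreal (pmf (p w) z)"
      by (simp add: emeasure_chain_cylinder path_prob_snoc ennreal_mult path_prob_nonneg)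
  qed
  also have "\<dots> = emeasure ?M {X. Q (map X [0..<Suc k]) \<and> X k = w} * ennreal (pmf (p w) z)"
    unfolding 1 by (rule nn_integral_multc) simp
  finally show ?thesis .
qed
text \<open>
  A chain that sits at \<open>x\<close> at time \<open>i\<close> has its mass dominated by \<open>\<nu> / \<nu> x\<close>, and an excessive measure
  keeps dominating after every further step. It is essential that the bound does not depend on the
  elapsed time \<open>t\<close>: no time is favourable for a visit to a state of small weight.
\<close>

lemma excessive_measure_bound:
  fixes \<nu> :: "nat \<Rightarrow> ennreal"
  assumes exc: "\<And>z. (\<integral>\<^sup>+w. \<nu> w * ennreal (pmf (p w) z) \<partial>count_space UNIV) \<le> \<nu> z"
  shows "\<nu> x * emeasure (chain_law p s) {X. X i = x \<and> X (i + t) = y} \<le> \<nu> y"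
proof (induction t arbitrary: y)
  case 0
  interpret prob_space "chain_law p s" by (rule prob_space_chain_law)
  show ?case
  proof (cases "x = y")
    case True
    have "\<nu> x * emeasure (chain_law p s) {X. X i = x \<and> X (i + 0) = y} \<le> \<nu> x * 1"
      by (intro mult_left_mono emeasure_le_1) auto
    with True show ?thesis by simp
  next
    case False
    then have "{X. X i = x \<and> X (i + 0) = y} = {}" by auto
    then show ?thesis by (metis emeasure_empty mult_zero_right zero_le)
  qed
next
  case (Suc t)
  let ?M = "chain_law p s" and ?k = "i + t"
  \<comment> \<open>the event of the past is the visit to \<open>x\<close> at time \<open>i\<close>\<close>
  let ?Q = "\<lambda>l :: nat list. l ! i = x"
  have Q: "?Q (map X [0..<Suc ?k]) \<longleftrightarrow> X i = x" for X :: "nat \<Rightarrow> nat"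
    by (subst nth_map) (auto simp del: upt_Suc)
  have [measurable]: "{X. X i = x \<and> X ?k = w \<and> X (Suc ?k) = y} \<in> sets path_space" for w
    using measurable_sets[OF measurable_path_coord, of "{x}" i]
      measurable_sets[OF measurable_path_coord, of "{w}" "?k"]
      measurable_sets[OF measurable_path_coord, of "{y}" "Suc ?k"] by (simp add: vimage_def Collect_conj_eq)
  have "{X. X i = x \<and> X (i + Suc t) = y} = (\<Union>w. {X. X i = x \<and> X ?k = w \<and> X (Suc ?k) = y})"
    by auto
  moreover have "disjoint_family_on (\<lambda>w. {X. X i = x \<and> X ?k = w \<and> X (Suc ?k) = y}) UNIV"
    by (auto simp: disjoint_family_on_def)
  ultimately have "emeasure ?M {X. X i = x \<and> X (i + Suc t) = y} =
      (\<integral>\<^sup>+w. emeasure ?M {X. X i = x \<and> X ?k = w \<and> X (Suc ?k) = y} \<partial>count_space UNIV)"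
    by (simp only:) (rule emeasure_UN_countable, auto)
  also have "\<dots> = (\<integral>\<^sup>+w. emeasure ?M {X. X i = x \<and> X ?k = w} * ennreal (pmf (p w) y) \<partial>count_space UNIV)"
    using emeasure_chain_step[of p s ?Q ?k _ y] by (simp only: Q)
  finally have "\<nu> x * emeasure ?M {X. X i = x \<and> X (i + Suc t) = y} =
     (\<integral>\<^sup>+w. \<nu> x * emeasure ?M {X. X i = x \<and> X ?k = w} * ennreal (pmf (p w) y) \<partial>count_space UNIV)"
    by (simp add: nn_integral_cmult mult.assoc)
  also have "\<dots> \<le> (\<integral>\<^sup>+w. \<nu> w * ennreal (pmf (p w) y) \<partial>count_space UNIV)"
    by (intro nn_integral_mono mult_right_mono Suc.IH) simp
  also have "\<dots> \<le> \<nu> y" by (rule exc)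
  finally show ?case .
qed

lemma AE_quenched_nearest_neighbour:
  assumes "\<omega> \<in> space env_space"
  shows "AE X in quenched \<omega>. X 0 = 0 \<and> (\<forall>k. \<bar>increment X k\<bar> = 1)"
proof -
  let ?M = "quenched \<omega>"
  have coord [measurable]: "{X. X k = w \<and> X m = z} \<in> sets path_space" for k m w z
    using measurable_sets[OF measurable_path_coord, of "{w}" k]
      measurable_sets[OF measurable_path_coord, of "{z}" m] by (simp add: vimage_def Collect_conj_eq)
  have null: "{X. X k = w \<and> X (Suc k) = z} \<in> null_sets ?M"
    if "z \<noteq> w + 1" "z + 1 \<noteq> w" for k w z
  proof (rule null_setsI)
    have "pmf (step \<omega> w) z = 0"
      using that env_space_in_unit[OF assms, of "int w"] by (subst pmf_step) auto
    then show "emeasure ?M {X. X k = w \<and> X (Suc k) = z} = 0"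
      using emeasure_chain_step[of "step \<omega>" 0 "\<lambda>_. True" k w z] by (simp add: quenched_def)
    show "{X. X k = w \<and> X (Suc k) = z} \<in> sets ?M"
      using coord[of k w "Suc k" z] by (simp add: quenched_def)
  qed
  have nn: "AE X in ?M. z \<noteq> w + 1 \<longrightarrow> z + 1 \<noteq> w \<longrightarrow> \<not> (X k = w \<and> X (Suc k) = z)" for k w z
  proof (cases "z \<noteq> w + 1 \<and> z + 1 \<noteq> w")
    case True
    then show ?thesis using AE_not_in[OF null, of z w k] by simp
  qed auto
  have "AE X in ?M. \<forall>k w z. z \<noteq> w + 1 \<longrightarrow> z + 1 \<noteq> w \<longrightarrow> \<not> (X k = w \<and> X (Suc k) = z)"
    unfolding AE_all_countable by (intro allI nn)
  moreover have "AE X in ?M. X 0 = 0"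
  proof -
    interpret prob_space ?M by (simp add: quenched_def prob_space_chain_law)
    have "emeasure ?M (cylinder [0]) = 1"
      by (simp add: quenched_def emeasure_chain_cylinder path_prob_def)
    then have "prob (cylinder [0]) = 1" by (simp add: measure_def)
    from AE_prob_1[OF this] show ?thesis by (simp add: cylinder_def)
  qed
  ultimately show ?thesis
  proof eventually_elim
    case (elim X)
    have "\<bar>increment X k\<bar> = 1" for k
    proof -
      have "X (Suc k) = X k + 1 \<or> X (Suc k) + 1 = X k" using elim(1) by blast
      then show ?thesis by (auto simp: increment_def)
    qed
    with elim show ?case by simp
  qed
qed

section \<open>Crossing a potential barrier in a fixed environment\<close>

text \<open>
  For the invariant measure constructed below this is the stationary flow through the edge between
  \<open>z\<close> and \<open>z + 1\<close>, the same in both directions; it is \<open>1\<close> on the edge at the origin.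
\<close>

definition flow :: "env \<Rightarrow> nat \<Rightarrow> real" where
  "flow \<omega> z = (\<Prod>i\<in>{1..<Suc z}. inverse (rho \<omega> (int i)))"

text \<open>
  The reversible measure of the walk, normalised to \<open>1\<close> at the reflecting origin: the weight of a
  site \<open>z > 0\<close> is fixed by its flow to the left, which is the weight times \<open>1 - \<omega> z\<close>.
\<close>

definition invariant_weight :: "env \<Rightarrow> nat \<Rightarrow> real" where
  "invariant_weight \<omega> z = (case z of 0 \<Rightarrow> 1 | Suc m \<Rightarrow> flow \<omega> m / (1 - \<omega> (int z)))"

lemma flow_pos: "(\<And>x. 0 < \<omega> x \<and> \<omega> x < 1) \<Longrightarrow> 0 < flow \<omega> z"
  unfolding flow_def by (intro prod_pos) (simp add: rho_def)

lemma invariant_weight_pos: "(\<And>x. 0 < \<omega> x \<and> \<omega> x < 1) \<Longrightarrow> 0 < invariant_weight \<omega> z"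
  by (auto simp: invariant_weight_def flow_pos split: nat.split)

text \<open>
  The weight arriving at \<open>z\<close> comes from its neighbours and equals the sum of the flows through
  the edges at \<open>z\<close>. By reversibility the same flows leave \<open>z\<close>, and their sum is the weight of \<open>z\<close>.
\<close>

lemma invariant_weight_excessive:
  assumes \<omega>: "\<And>x. 0 < \<omega> x \<and> \<omega> x < 1"
  shows "(\<integral>\<^sup>+w. ennreal (invariant_weight \<omega> w) * ennreal (pmf (step \<omega> w) z) \<partial>count_space UNIV)
    \<le> ennreal (invariant_weight \<omega> z)"
proof -
  let ?\<nu> = "invariant_weight \<omega>"
  have flow_nonneg: "0 \<le> flow \<omega> x" and \<nu>_nonneg: "0 \<le> ?\<nu> x" for x
    using flow_pos[where \<omega> = \<omega> and z = x, OF \<omega>] invariant_weight_pos[where \<omega> = \<omega> and z = x, OF \<omega>] by simp_all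
  have step: "pmf (step \<omega> x) y = (if x = 0 then of_bool (y = 1)
     else if y = x + 1 then \<omega> (int x) else if y + 1 = x then 1 - \<omega> (int x) else 0)" for x y
    using \<omega>[of "int x"] by (intro pmf_step) auto
  have down: "?\<nu> (Suc x) * pmf (step \<omega> (Suc x)) x = flow \<omega> x" for x
    using \<omega>[of "int (Suc x)"] by (simp add: step invariant_weight_def)
  have flow_Suc: "flow \<omega> (Suc x) = flow \<omega> x * (\<omega> (int (Suc x)) / (1 - \<omega> (int (Suc x))))" for x
    by (simp add: flow_def rho_def)
  have up: "?\<nu> x * pmf (step \<omega> x) (Suc x) = flow \<omega> x" for x
  proof (cases x)
    case 0
    then show ?thesis by (simp add: step invariant_weight_def flow_def)
  next
    case (Suc m)
    then show ?thesis by (simp add: step invariant_weight_def flow_Suc)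
  qed
  \<comment> \<open>for \<open>z = 0\<close> the term of \<open>z - 1 = 0\<close> vanishes, because the walk never stays put\<close>
  have "(\<integral>\<^sup>+w. ennreal (?\<nu> w) * ennreal (pmf (step \<omega> w) z) \<partial>count_space UNIV) =
      (\<Sum>w\<in>{z - 1, Suc z}. ennreal (?\<nu> w) * ennreal (pmf (step \<omega> w) z))"
    by (rule nn_integral_count_space') (auto simp: step)
  also have "\<dots> = ennreal (?\<nu> (z - 1) * pmf (step \<omega> (z - 1)) z + flow \<omega> z)"
    using \<nu>_nonneg flow_nonneg down[of z] by (simp add: ennreal_mult'[symmetric] del: down)
  also have "?\<nu> (z - 1) * pmf (step \<omega> (z - 1)) z + flow \<omega> z = ?\<nu> z"
  proof (cases z)
    case 0
    then show ?thesis by (simp add: step invariant_weight_def flow_def)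
  next
    case (Suc m)
    then show ?thesis
      using up[of m] \<omega>[of "int z"] by (simp add: flow_Suc invariant_weight_def field_simps)
  qed
  finally show ?thesis by simp
qed

lemma invariant_weight_ratio:
  assumes \<omega>: "\<And>x. 0 < \<omega> x \<and> \<omega> x < 1" and "1 \<le> x" "x \<le> y"
  shows "invariant_weight \<omega> y * (1 - \<omega> (int y)) =
    invariant_weight \<omega> x * (1 - \<omega> (int x)) * exp (- (\<Sum>i\<in>{x..<y}. ln (rho \<omega> (int i))))"
proof -
  have rho_pos: "0 < rho \<omega> x" for x using \<omega>[of x] by (simp add: rho_def)
  have w: "invariant_weight \<omega> z * (1 - \<omega> (int z)) = (\<Prod>i\<in>{1..<z}. inverse (rho \<omega> (int i)))"
    if "1 \<le> z" for z
    using that \<omega>[of "int z"] by (cases z) (auto simp: invariant_weight_def flow_def)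
  have "exp (- (\<Sum>i\<in>{x..<y}. ln (rho \<omega> (int i)))) = (\<Prod>i\<in>{x..<y}. inverse (rho \<omega> (int i)))"
    by (simp add: sum_negf[symmetric] exp_sum exp_minus rho_pos)
  moreover have "{1..<y} = {1..<x} \<union> {x..<y}" using assms by auto
  ultimately show ?thesis
    using assms by (simp only: w order.trans[of 1 x y]) (simp add: prod.union_disjoint)
qed

text \<open>
  A walk at or above \<open>y\<close> at time \<open>n\<close> has visited \<open>x\<close> and later \<open>y\<close>, since it moves by unit steps.
  There are at most \<open>(n + 1)\<^sup>2\<close> choices for the two times of visit, and for each of them the
  probability is bounded by the ratio of the weights of \<open>y\<close> and \<open>x\<close>, which is exponentially
  small in the increase of the potential \<open>\<Sum> ln (rho \<omega> i)\<close> between \<open>x\<close> and \<open>y\<close>.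
\<close>

lemma quenched_prob_ge_le:
  assumes \<omega>: "\<omega> \<in> space env_space" "\<And>x. \<delta> \<le> \<omega> x \<and> \<omega> x \<le> 1 - \<delta>" and \<delta>: "0 < \<delta>"
    and xy: "1 \<le> x" "x < y"
  shows "emeasure (quenched \<omega>) {X. y \<le> X n} \<le>
    ennreal ((real n + 1)\<^sup>2 * (exp (- (\<Sum>i\<in>{x..<y}. ln (rho \<omega> (int i)))) / \<delta>))"
proof -
  let ?\<nu> = "invariant_weight \<omega>" and ?M = "quenched \<omega>"
  define E where "E = exp (- (\<Sum>i\<in>{x..<y}. ln (rho \<omega> (int i))))"
  have \<omega>01: "0 < \<omega> z \<and> \<omega> z < 1" for z using \<omega>(2)[of z] \<delta> by linarith
  have \<nu>_pos: "0 < ?\<nu> z" for z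
    using \<omega>01 by (rule invariant_weight_pos)
  have "?\<nu> y * \<delta> \<le> ?\<nu> y * (1 - \<omega> (int y))"
    using \<omega>(2)[of "int y"] \<nu>_pos[of y] by (intro mult_left_mono) auto
  also have "\<dots> = ?\<nu> x * (1 - \<omega> (int x)) * E"
    unfolding E_def using xy by (intro invariant_weight_ratio \<omega>01) auto
  also have "\<dots> \<le> ?\<nu> x * 1 * E"
    using \<nu>_pos[of x] \<omega>01[of "int x"] by (intro mult_right_mono mult_left_mono) (auto simp: E_def)
  finally have "?\<nu> y \<le> ?\<nu> x * (E / \<delta>)" using \<delta> by (simp add: field_simps)
  have visit: "emeasure ?M {X. X i = x \<and> X (i + t) = y} \<le> ennreal (E / \<delta>)" for i t
  proof -
    have "ennreal (?\<nu> x) * emeasure ?M {X. X i = x \<and> X (i + t) = y} \<le> ennreal (?\<nu> y)"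
      unfolding quenched_def
      by (rule excessive_measure_bound) (rule invariant_weight_excessive[OF \<omega>01])
    also have "\<dots> \<le> ennreal (?\<nu> x) * ennreal (E / \<delta>)"
      using \<open>?\<nu> y \<le> _\<close> \<nu>_pos[of x] by (simp add: ennreal_mult'[symmetric] ennreal_leI)
    finally show ?thesis
      using \<nu>_pos[of x] by (simp add: ennreal_mult_le_mult_iff)
  qed
  have [measurable]: "{X. X i = x \<and> X (i + t) = y} \<in> sets path_space" for i t
    using measurable_sets[OF measurable_path_coord, of "{x}" i]
      measurable_sets[OF measurable_path_coord, of "{y}" "i + t"] by (simp add: vimage_def Collect_conj_eq)
  let ?V = "\<lambda>(i, t). {X :: nat \<Rightarrow> nat. X i = x \<and> X (i + t) = y}"
  let ?I = "{..n} \<times> {..n}"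
  have "emeasure ?M {X. y \<le> X n} \<le> emeasure ?M (\<Union>p\<in>?I. ?V p)"
  proof (rule emeasure_mono_AE)
    show "AE X in ?M. X \<in> {X. y \<le> X n} \<longrightarrow> X \<in> (\<Union>p\<in>?I. ?V p)"
      using AE_quenched_nearest_neighbour[OF \<omega>(1)]
    proof eventually_elim
      case (elim X)
      have nn: "\<forall>i. a \<le> i \<and> i < b \<longrightarrow> \<bar>int (X (Suc i)) - int (X i)\<bar> \<le> 1" for a b
        using elim by (simp add: increment_def)
      show ?case
      proof
        assume "X \<in> {X. y \<le> X n}"
        then obtain j where j: "j \<le> n" "X j = y"
          using nat_intermed_int_val[OF nn, of 0 n "int y"] elim by auto
        then obtain i where i: "i \<le> j" "X i = x"
          using nat_intermed_int_val[OF nn, of 0 j "int x"] elim xy by auto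
        from i j show "X \<in> (\<Union>p\<in>?I. ?V p)"
          by (intro UN_I[of "(i, j - i)"]) auto
      qed
    qed
    show "(\<Union>p\<in>?I. ?V p) \<in> sets ?M" by (auto simp: quenched_def)
  qed
  also have "\<dots> \<le> (\<Sum>p\<in>?I. emeasure ?M (?V p))"
    by (intro emeasure_subadditive_finite) (auto simp: quenched_def)
  also have "\<dots> \<le> of_nat (card ?I) * ennreal (E / \<delta>)"
    using visit by (intro sum_bounded_above) auto
  also have "\<dots> = ennreal ((real n + 1)\<^sup>2 * (E / \<delta>))"
  proof -
    have "(of_nat (card ?I) :: ennreal) = ennreal ((real n + 1)\<^sup>2)"
      by (simp add: ennreal_of_nat_eq_real_of_nat power2_eq_square algebra_simps)
    then show ?thesis using \<delta> by (simp add: ennreal_mult'[symmetric] E_def)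
  qed
  finally show ?thesis unfolding E_def .
qed

section \<open>Sums over blocks of i.i.d. variables\<close>

context prob_space
begin

text \<open>
  The characteristic function of a sum of i.i.d. variables depends on the index set through its
  cardinality only.
\<close>

lemma distr_sum_iid_cong:
  fixes X :: "'i \<Rightarrow> 'a \<Rightarrow> real"
  assumes ind: "indep_vars (\<lambda>_. borel) X UNIV" and id: "\<And>i. distr M borel (X i) = \<mu>"
    and "card I = card J"
  shows "distr M borel (\<lambda>\<omega>. \<Sum>i\<in>I. X i \<omega>) = distr M borel (\<lambda>\<omega>. \<Sum>i\<in>J. X i \<omega>)"
proof (rule Levy_uniqueness)
  have [measurable]: "X i \<in> borel_measurable M" for i
    using ind by (simp add: indep_vars_def2)
  show "real_distribution (distr M borel (\<lambda>\<omega>. \<Sum>i\<in>I. X i \<omega>))"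
    "real_distribution (distr M borel (\<lambda>\<omega>. \<Sum>i\<in>J. X i \<omega>))"
    by (rule real_distribution_distr, measurable)+
  have "indep_vars (\<lambda>_. borel) X K" for K
    using ind by (rule indep_vars_subset) simp
  then show "char (distr M borel (\<lambda>\<omega>. \<Sum>i\<in>I. X i \<omega>)) = char (distr M borel (\<lambda>\<omega>. \<Sum>i\<in>J. X i \<omega>))"
    by (intro ext) (simp add: char_distr_sum id assms(3))
qed

text \<open>
  Consecutive blocks of length \<open>r\<close> have independent, identically distributed sums. The first block
  starts at \<open>1\<close> because site \<open>0\<close> is reflecting and does not contribute to the potential.
\<close>

lemma prob_all_blocks_le:
  fixes X :: "nat \<Rightarrow> 'a \<Rightarrow> real"
  assumes ind: "indep_vars (\<lambda>_. borel) X UNIV" and id: "\<And>i. distr M borel (X i) = \<mu>"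
    and "0 < k"
  shows "prob {\<omega> \<in> space M. \<forall>j<k. (\<Sum>i\<in>{1 + j * r..<1 + Suc j * r}. X i \<omega>) \<le> c} =
    prob {\<omega> \<in> space M. (\<Sum>i<r. X i \<omega>) \<le> c} ^ k"
proof -
  have [measurable]: "X i \<in> borel_measurable M" for i
    using ind by (simp add: indep_vars_def2)
  define B where "B j = {1 + j * r..<1 + Suc j * r}" for j
  have disj: "disjoint_family_on B {..<k}"
  proof (unfold disjoint_family_on_def, intro ballI impI)
    fix i j :: nat assume "i \<noteq> j"
    then have "Suc i \<le> j \<or> Suc j \<le> i" by linarith
    then have "Suc i * r \<le> j * r \<or> Suc j * r \<le> i * r" using mult_le_mono1 by blast
    then show "B i \<inter> B j = {}" unfolding B_def by auto
  qed
  define S where "S j \<omega> = (\<Sum>i\<in>B j. X i \<omega>)" for j \<omega>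
  have S_meas [measurable]: "S j \<in> borel_measurable M" for j unfolding S_def by measurable
  have "indep_vars (\<lambda>j. PiM (B j) (\<lambda>_. borel)) (\<lambda>j \<omega>. restrict (\<lambda>i. X i \<omega>) (B j)) {..<k}"
    by (rule indep_vars_restrict[OF ind _ disj]) simp
  then have "indep_vars (\<lambda>_. borel) (\<lambda>j \<omega>. \<Sum>i\<in>B j. restrict (\<lambda>i. X i \<omega>) (B j) i) {..<k}"
    by (rule indep_vars_compose2) measurable
  then have indS: "indep_vars (\<lambda>_. borel) S {..<k}"
    by (simp add: S_def[abs_def])
  have same: "prob (S j -` {..c} \<inter> space M) = prob {\<omega> \<in> space M. (\<Sum>i<r. X i \<omega>) \<le> c}" for j
  proof -
    have "prob (S j -` {..c} \<inter> space M) = measure (distr M borel (\<lambda>\<omega>. \<Sum>i\<in>B j. X i \<omega>)) {..c}"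
      unfolding S_def by (subst measure_distr) auto
    also have "\<dots> = measure (distr M borel (\<lambda>\<omega>. \<Sum>i<r. X i \<omega>)) {..c}"
      by (subst distr_sum_iid_cong[OF ind id, of "B j" "{..<r}"]) (simp_all add: B_def)
    also have "\<dots> = prob {\<omega> \<in> space M. (\<Sum>i<r. X i \<omega>) \<le> c}"
      by (subst measure_distr) (auto intro!: arg_cong[where f = prob])
    finally show ?thesis .
  qed
  have "{\<omega> \<in> space M. \<forall>j<k. S j \<omega> \<le> c} = (\<Inter>j\<in>{..<k}. S j -` {..c} \<inter> space M)"
    using \<open>0 < k\<close> by auto
  moreover have "prob \<dots> = (\<Prod>j<k. prob (S j -` {..c} \<inter> space M))"
    using \<open>0 < k\<close> by (intro indep_varsD_finite[OF indS]) auto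
  ultimately show ?thesis by (simp add: same S_def B_def)
qed

end

lemma cdf_std_normal_less_1: "cdf std_normal_distribution x < 1"
proof -
  interpret real_distribution std_normal_distribution by (rule real_dist_normal_dist)
  have pos: "std_normal_density y \<noteq> 0" for y
    using normal_density_pos[of 1 0 y] by simp
  have "emeasure std_normal_distribution {x<..} \<noteq> 0"
  proof
    assume "emeasure std_normal_distribution {x<..} = 0"
    then have "AE y in lborel. ennreal (std_normal_density y) * indicator {x<..} y = 0"
      by (subst (asm) emeasure_density) (simp_all add: nn_integral_0_iff_AE)
    then have "AE y in lborel. y \<notin> {x<..<x+1}"
      by eventually_elim (auto simp: pos)
    then have "{x<..<x+1} \<in> null_sets lborel"
      using AE_iff_null_sets[of "{x<..<x+1}" lborel] by simp
    then have "emeasure lborel {x<..<x+1} = 0" by (rule null_setsD1)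
    moreover have "emeasure lborel {x<..<x+1} = ennreal (x + 1 - x)"
      by (rule emeasure_lborel_Ioo) simp
    ultimately show False by simp
  qed
  then have "prob {x<..} \<noteq> 0" by (simp add: emeasure_eq_measure)
  moreover have "{x<..} = space std_normal_distribution - {..x}" by auto
  then have "prob {x<..} = 1 - prob {..x}" using prob_compl[of "{..x}"] by simp
  ultimately have "cdf std_normal_distribution x \<noteq> 1" by (simp add: cdf_def)
  then show ?thesis using cdf_bounded_prob[of x] by simp
qed

lemma isCont_cdf_std_normal: "isCont (cdf std_normal_distribution) x"
proof -
  interpret real_distribution std_normal_distribution by (rule real_dist_normal_dist)
  have "AE y in lborel. ennreal (std_normal_density y) * indicator {x} y = 0"
    using AE_lborel_singleton[of x] by eventually_elim (simp add: indicator_def)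
  then have "emeasure std_normal_distribution {x} = 0"
    by (subst emeasure_density) (simp_all add: nn_integral_0_iff_AE)
  then show ?thesis by (simp add: isCont_cdf measure_def)
qed

text \<open>
  Only one consequence of the central limit theorem matters: a sum of \<open>r\<close> variables exceeds its
  standard deviation with a probability that stays away from \<open>0\<close>, as the limit is less than \<open>1\<close>
  by \<open>cdf_std_normal_less_1\<close>.
\<close>

lemma (in prob_space) prob_sum_le_sqrt_tendsto:
  fixes X :: "nat \<Rightarrow> 'a \<Rightarrow> real"
  assumes ind: "indep_vars (\<lambda>_. borel) X UNIV" and id: "\<And>i. distr M borel (X i) = \<mu>"
    and "\<And>n. expectation (X n) = 0" "\<sigma> > 0" "\<And>n. integrable M (\<lambda>x. (X n x)\<^sup>2)"
    "\<And>n. variance (X n) = \<sigma>\<^sup>2"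
  shows "(\<lambda>r. prob {\<omega> \<in> space M. (\<Sum>i<r. X i \<omega>) \<le> sqrt (real r * \<sigma>\<^sup>2)})
    \<longlonglongrightarrow> cdf std_normal_distribution 1"
proof -
  have [measurable]: "X i \<in> borel_measurable M" for i
    using ind by (simp add: indep_vars_def2)
  have "weak_conv_m (\<lambda>n. distr M borel (\<lambda>x. (\<Sum>i<n. X i x) / sqrt (n * \<sigma>\<^sup>2))) std_normal_distribution"
    using assms by (intro central_limit_theorem_zero_mean)
  then have "(\<lambda>n. cdf (distr M borel (\<lambda>x. (\<Sum>i<n. X i x) / sqrt (n * \<sigma>\<^sup>2))) 1)
      \<longlonglongrightarrow> cdf std_normal_distribution 1"
    by (simp add: weak_conv_m_def weak_conv_def isCont_cdf_std_normal)
  moreover have "\<forall>\<^sub>F n in sequentially. cdf (distr M borel (\<lambda>x. (\<Sum>i<n. X i x) / sqrt (n * \<sigma>\<^sup>2))) 1 =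
      prob {\<omega> \<in> space M. (\<Sum>i<n. X i \<omega>) \<le> sqrt (real n * \<sigma>\<^sup>2)}"
    using eventually_gt_at_top[of 0]
  proof eventually_elim
    case (elim n)
    have "0 < sqrt (real n * \<sigma>\<^sup>2)" using elim \<open>\<sigma> > 0\<close> by simp
    then have "(\<Sum>i<n. X i \<omega>) / sqrt (real n * \<sigma>\<^sup>2) \<le> 1 \<longleftrightarrow>
        (\<Sum>i<n. X i \<omega>) \<le> sqrt (real n * \<sigma>\<^sup>2)" for \<omega>
      by (simp only: pos_divide_le_eq mult_1)
    then have "(\<lambda>\<omega>. (\<Sum>i<n. X i \<omega>) / sqrt (real n * \<sigma>\<^sup>2)) -` {..1} \<inter> space M =
        {\<omega> \<in> space M. (\<Sum>i<n. X i \<omega>) \<le> sqrt (real n * \<sigma>\<^sup>2)}"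
      by blast
    then show ?case
      unfolding cdf_def by (subst measure_distr) simp_all
  qed
  ultimately show ?thesis by (rule Lim_transform_eventually)
qed

section \<open>Independent and identically distributed environments\<close>

locale iid_environment =
  fixes P :: "env measure"
  assumes iid: "iid_env P"
begin

sublocale prob_space P using iid by (simp add: iid_env_def)

lemma sets_P [measurable_cong, simp]: "sets P = sets env_space"
  using iid by (simp add: iid_env_def)

lemma space_P [simp]: "space P = space env_space"
  by (rule sets_eq_imp_space_eq) simp

abbreviation "log_rho i \<omega> \<equiv> ln (rho \<omega> (int i))"

lemma measurable_log_rho [measurable]: "log_rho i \<in> borel_measurable env_space"
  unfolding rho_def by measurable

lemma site_measurable: "(\<lambda>\<omega>. \<omega> x) \<in> P \<rightarrow>\<^sub>M unit_interval"
  using iid by (simp add: iid_env_def indep_vars_def2)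

text \<open>
  The environment is indexed by all integers, the walk lives on the non-negative ones. Grouping the
  sites into the singletons \<open>{int j}\<close> moves independence to the index set of the naturals.
\<close>

lemma indep_log_rho: "indep_vars (\<lambda>_. borel) log_rho UNIV"
proof -
  have "indep_vars (\<lambda>j. PiM {int j} (\<lambda>_. unit_interval)) (\<lambda>j \<omega>. restrict (\<lambda>x. \<omega> x) {int j}) UNIV"
    using iid by (intro indep_vars_restrict[where I = UNIV]) (auto simp: iid_env_def disjoint_family_on_def)
  then have "indep_vars (\<lambda>_. borel)
      (\<lambda>j \<omega>. (\<lambda>v. ln ((1 - v (int j)) / v (int j))) (restrict (\<lambda>x. \<omega> x) {int j})) UNIV"
  proof (rule indep_vars_compose2)
    fix j :: nat
    have "(\<lambda>v. v (int j)) \<in> PiM {int j} (\<lambda>_. unit_interval) \<rightarrow>\<^sub>M unit_interval"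
      by (rule measurable_component_singleton) simp
    then have [measurable]: "(\<lambda>v. v (int j)) \<in> borel_measurable (PiM {int j} (\<lambda>_. unit_interval))"
      by (simp add: measurable_restrict_space2_iff)
    show "(\<lambda>v. ln ((1 - v (int j)) / v (int j))) \<in> borel_measurable (PiM {int j} (\<lambda>_. unit_interval))"
      by measurable
  qed
  then show ?thesis by (simp add: rho_def[abs_def])
qed

lemma distr_log_rho: "distr P borel (log_rho i) = distr P borel (log_rho 0)"
proof -
  let ?g = "\<lambda>v :: real. ln ((1 - v) / v)"
  have g: "?g \<in> unit_interval \<rightarrow>\<^sub>M borel"
    by (rule measurable_restrict_space1) measurable
  have "distr P borel (log_rho i) = distr (distr P unit_interval (\<lambda>\<omega>. \<omega> (int i))) borel ?g" for i
    by (subst distr_distr[OF g site_measurable]) (simp add: comp_def rho_def)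
  moreover have "distr P unit_interval (\<lambda>\<omega>. \<omega> (int i)) = distr P unit_interval (\<lambda>\<omega>. \<omega> 0)" for i
    using iid unfolding iid_env_def by blast
  ultimately have "distr P borel (log_rho i) = distr (distr P unit_interval (\<lambda>\<omega>. \<omega> 0)) borel ?g" for i
    by (simp only:)
  from this[of i] this[of 0] show ?thesis by (simp only:)
qed

lemma AE_all_sites:
  assumes "AE \<omega> in P. \<omega> 0 \<in> A" "A \<in> sets borel"
  shows "AE \<omega> in P. \<forall>x. \<omega> x \<in> A"
proof -
  have A: "{v \<in> space unit_interval. v \<in> A} \<in> sets unit_interval"
    using assms(2) by (auto simp: sets_restrict_space space_restrict_space)
  have "AE \<omega> in P. \<omega> x \<in> A" for x
  proof -
    have "distr P unit_interval (\<lambda>\<omega>. \<omega> x) = distr P unit_interval (\<lambda>\<omega>. \<omega> 0)"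
      using iid unfolding iid_env_def by blast
    moreover have "AE v in distr P unit_interval (\<lambda>\<omega>. \<omega> 0). v \<in> A"
      using assms(1) AE_distr_iff[OF site_measurable A] by simp
    ultimately have "AE v in distr P unit_interval (\<lambda>\<omega>. \<omega> x). v \<in> A" by (simp only:)
    then show ?thesis using AE_distr_iff[OF site_measurable A] by simp
  qed
  then show ?thesis by (simp add: AE_all_countable)
qed

lemma emeasure_annealed_path_event:
  assumes "G \<in> sets path_space"
  shows "emeasure (annealed P) {z \<in> space (annealed P). snd z \<in> G} = (\<integral>\<^sup>+\<omega>. emeasure (quenched \<omega>) G \<partial>P)"
proof -
  have "space (annealed P) = space env_space \<times> UNIV"
    using sets_eq_imp_space_eq[OF sets_annealed[OF prob_space_axioms sets_P]] by (simp add: space_pair_measure)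
  then have "{z \<in> space (annealed P). snd z \<in> G} = space env_space \<times> G" by auto
  then have "emeasure (annealed P) {z \<in> space (annealed P). snd z \<in> G} =
      (\<integral>\<^sup>+\<omega>\<in>space env_space. emeasure (quenched \<omega>) G \<partial>P)"
    using emeasure_annealed_Times[OF prob_space_axioms sets_P sets.top assms] by simp
  also have "\<dots> = (\<integral>\<^sup>+\<omega>. emeasure (quenched \<omega>) G \<partial>P)"
    by (intro nn_integral_cong) simp
  finally show ?thesis .
qed

lemma AE_annealed_nearest_neighbour:
  "AE z in annealed P. snd z 0 = 0 \<and> (\<forall>k. \<bar>increment (snd z) k\<bar> = 1)"
proof -
  let ?G = "{X. \<not> (X 0 = 0 \<and> (\<forall>k. \<bar>increment X k\<bar> = 1))}"
  have G: "?G \<in> sets path_space"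
  proof -
    have "{X \<in> space path_space. \<not> (X 0 = 0 \<and> (\<forall>k. \<bar>increment X k\<bar> = 1))} \<in> sets path_space"
      unfolding increment_def by measurable
    then show ?thesis by simp
  qed
  have "(\<integral>\<^sup>+\<omega>. emeasure (quenched \<omega>) ?G \<partial>P) = (\<integral>\<^sup>+\<omega>. 0 \<partial>P)"
  proof (rule nn_integral_cong)
    fix \<omega> assume "\<omega> \<in> space P"
    then have "AE X in quenched \<omega>. X 0 = 0 \<and> (\<forall>k. \<bar>increment X k\<bar> = 1)"
      by (intro AE_quenched_nearest_neighbour) simp
    then show "emeasure (quenched \<omega>) ?G = 0"
      using G by (subst (asm) AE_iff_measurable[OF _ refl]) (auto simp: quenched_def)
  qed
  then have "emeasure (annealed P) {z \<in> space (annealed P). snd z \<in> ?G} = 0"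
    using emeasure_annealed_path_event[OF G] by simp
  moreover have "{z \<in> space (annealed P). snd z \<in> ?G} \<in> sets (annealed P)"
  proof -
    have "snd \<in> annealed P \<rightarrow>\<^sub>M path_space"
      by (simp add: measurable_cong_sets[OF sets_annealed[OF prob_space_axioms sets_P] refl])
    from measurable_sets[OF this G] show ?thesis by (simp add: vimage_def Int_def conj_commute)
  qed
  ultimately show ?thesis
    by (subst AE_iff_measurable) (auto)
qed

end

section \<open>Vanishing speed under the annealed law\<close>

context iid_environment
begin

text \<open>
  Either all \<open>k\<close> blocks of length \<open>r\<close> raise the potential by at most \<open>c\<close>, or one of them raises it
  by more than \<open>c\<close>. A walk that gets beyond \<open>k * r\<close> has to cross this block from left to right, which
  is unlikely by \<open>quenched_prob_ge_le\<close>.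
\<close>

lemma annealed_exceed_le:
  fixes r :: nat
  assumes sites: "AE \<omega> in P. \<forall>x. \<delta> \<le> \<omega> x \<and> \<omega> x \<le> 1 - \<delta>" and \<delta>: "0 < \<delta>" and k: "0 < k" and c: "0 \<le> c"
  shows "(\<integral>\<^sup>+\<omega>. emeasure (quenched \<omega>) {X. k * r < X n} \<partial>P) \<le>
    ennreal (prob {\<omega> \<in> space P. (\<Sum>i<r. log_rho i \<omega>) \<le> c} ^ k + (real n + 1)\<^sup>2 * (exp (- c) / \<delta>))"
proof -
  let ?K = "(real n + 1)\<^sup>2 * (exp (- c) / \<delta>)"
  let ?S = "\<lambda>j \<omega>. \<Sum>i\<in>{1 + j * r..<1 + Suc j * r}. log_rho i \<omega>"
  define E where "E = {\<omega> \<in> space P. \<forall>j<k. ?S j \<omega> \<le> c}"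
  have E [measurable]: "E \<in> sets P" unfolding E_def by measurable
  have "(\<integral>\<^sup>+\<omega>. emeasure (quenched \<omega>) {X. k * r < X n} \<partial>P) \<le>
      (\<integral>\<^sup>+\<omega>. indicator E \<omega> + ennreal ?K \<partial>P)"
  proof (rule nn_integral_mono_AE)
    show "AE \<omega> in P. emeasure (quenched \<omega>) {X. k * r < X n} \<le> indicator E \<omega> + ennreal ?K"
      using sites AE_space
    proof eventually_elim
      case (elim \<omega>)
      interpret Q: prob_space "quenched \<omega>" by (simp add: quenched_def prob_space_chain_law)
      show ?case
      proof (cases "\<omega> \<in> E")
        case True
        have "emeasure (quenched \<omega>) {X. k * r < X n} \<le> 1" by (rule Q.emeasure_le_1)
        with True show ?thesis by (simp add: add_increasing2)
      next
        case False
        with elim obtain j where j: "j < k" "c < ?S j \<omega>" by (auto simp: E_def not_le)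
        \<comment> \<open>an empty block has sum \<open>0\<close>, which does not exceed \<open>c\<close>\<close>
        have "0 < r"
        proof (rule ccontr)
          assume "\<not> 0 < r"
          with j c show False by simp
        qed
        have "Suc j * r \<le> k * r" using j(1) by (intro mult_le_mono1) simp
        then have "emeasure (quenched \<omega>) {X. k * r < X n} \<le> emeasure (quenched \<omega>) {X. 1 + Suc j * r \<le> X n}"
        proof (intro emeasure_mono)
          have "{X \<in> space path_space. 1 + Suc j * r \<le> X n} \<in> sets path_space" by measurable
          then show "{X. 1 + Suc j * r \<le> X n} \<in> sets (quenched \<omega>)" by (simp add: quenched_def)
        qed auto
        also have "\<dots> \<le> ennreal ((real n + 1)\<^sup>2 * (exp (- ?S j \<omega>) / \<delta>))"
          using elim \<open>0 < r\<close> \<delta> by (intro quenched_prob_ge_le) auto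
        also have "\<dots> \<le> ennreal ?K"
          using j(2) \<delta> by (intro ennreal_leI mult_left_mono divide_right_mono) auto
        finally show ?thesis by (simp add: add_increasing)
      qed
    qed
  qed
  also have "\<dots> = emeasure P E + ennreal ?K * emeasure P (space P)"
    using E by (subst nn_integral_add) (simp_all del: space_P)
  also have "\<dots> = ennreal (prob E) + ennreal ?K"
    by (simp only: emeasure_space_1 emeasure_eq_measure[of E] mult_1_right)
  also have "prob E = prob {\<omega> \<in> space P. (\<Sum>i<r. log_rho i \<omega>) \<le> c} ^ k"
    unfolding E_def by (rule prob_all_blocks_le[OF indep_log_rho distr_log_rho k])
  finally show ?thesis using \<delta> by (simp add: ennreal_plus[symmetric] del: ennreal_plus)
qed

text \<open>
  Cut the first \<open>\<epsilon> n\<close> sites into \<open>k\<close> blocks of length \<open>r n\<close>, about \<open>\<epsilon> n / k\<close>, and call a block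
  high if it raises the potential by more than its standard deviation. The potential barrier of a
  high block is of order \<open>sqrt n\<close>, which beats the polynomial number of pairs of visit times. The
  probability that no block is high tends to the \<open>k\<close>-th power of a number less than \<open>1\<close>, and
  \<open>k\<close> is arbitrary.
\<close>

lemma annealed_speed_zero:
  assumes sites: "AE \<omega> in P. \<forall>x. \<delta> \<le> \<omega> x \<and> \<omega> x \<le> 1 - \<delta>" and \<delta>: "0 < \<delta>"
    and mean: "expectation (log_rho 0) = 0" and var: "0 < variance (log_rho 0)" and \<epsilon>: "0 < \<epsilon>"
  shows "(\<lambda>n. measure (annealed P) {z \<in> space (annealed P). \<epsilon> * real n < real (snd z n)}) \<longlonglongrightarrow> 0"
proof (rule order_tendstoI)
  fix \<eta> :: real assume \<eta>: "0 < \<eta>"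
  let ?a = "\<lambda>n. measure (annealed P) {z \<in> space (annealed P). \<epsilon> * real n < real (snd z n)}"
  let ?\<Phi> = "cdf std_normal_distribution 1"
  define \<sigma> where "\<sigma> = sqrt (variance (log_rho 0))"
  have \<sigma>: "0 < \<sigma>" using var by (simp add: \<sigma>_def)
  let ?q = "\<lambda>r. prob {\<omega> \<in> space P. (\<Sum>i<r. log_rho i \<omega>) \<le> sqrt (real r * \<sigma>\<^sup>2)}"
  have log_bound: "AE \<omega> in P. \<bar>log_rho i \<omega>\<bar> \<le> ln (1 / \<delta>)" for i
    using sites
  proof eventually_elim
    case (elim \<omega>)
    have w: "\<delta> \<le> \<omega> (int i)" "\<omega> (int i) \<le> 1 - \<delta>" using elim by auto
    have "ln (1 - \<omega> (int i)) \<le> 0" "ln (\<omega> (int i)) \<le> 0" "ln \<delta> \<le> ln (\<omega> (int i))" "ln \<delta> \<le> ln (1 - \<omega> (int i))"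
      using w \<delta> by auto
    moreover have "log_rho i \<omega> = ln (1 - \<omega> (int i)) - ln (\<omega> (int i))"
      using w \<delta> ln_div[of "1 - \<omega> (int i)" "\<omega> (int i)"] by (simp add: rho_def)
    ultimately show ?case using \<delta> by (simp add: ln_div abs_le_iff)
  qed
  have sq: "integrable P (\<lambda>\<omega>. (log_rho i \<omega>)\<^sup>2)" for i
  proof (rule integrable_const_bound[where B = "(ln (1 / \<delta>))\<^sup>2"])
    show "AE \<omega> in P. norm ((log_rho i \<omega>)\<^sup>2) \<le> (ln (1 / \<delta>))\<^sup>2"
      using log_bound[of i] by eventually_elim (metis abs_ge_zero norm_power power2_abs power_mono real_norm_def)
  qed simp
  have expect: "expectation (\<lambda>\<omega>. g (log_rho i \<omega>)) = expectation (\<lambda>\<omega>. g (log_rho 0 \<omega>))"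
    if [measurable]: "g \<in> borel_measurable borel" for g :: "real \<Rightarrow> real" and i
  proof -
    have "expectation (\<lambda>\<omega>. g (log_rho j \<omega>)) = integral\<^sup>L (distr P borel (log_rho j)) g" for j
      by (rule integral_distr[symmetric]) simp_all
    from this[of i] this[of 0] show ?thesis by (simp only: distr_log_rho[of i])
  qed
  have mean': "expectation (log_rho i) = 0" for i
    using expect[of "\<lambda>v. v" i] mean by simp
  have var': "variance (log_rho i) = \<sigma>\<^sup>2" for i
    using expect[of "\<lambda>v. v\<^sup>2" i] var mean by (simp add: mean' \<sigma>_def)
  have q: "?q \<longlonglongrightarrow> ?\<Phi>"
    by (rule prob_sum_le_sqrt_tendsto[OF indep_log_rho distr_log_rho mean' \<sigma> sq var'])
  have "0 \<le> ?\<Phi>" by (simp add: cdf_def)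
  then have "(\<lambda>k. ?\<Phi> ^ k) \<longlonglongrightarrow> 0"
    using cdf_std_normal_less_1[of 1] by (intro LIMSEQ_power_zero) simp
  then have "\<forall>\<^sub>F k in sequentially. ?\<Phi> ^ k < \<eta> \<and> 0 < k"
    using order_tendstoD(2)[OF _ \<eta>] eventually_gt_at_top[of 0] by (intro eventually_conj) auto
  then obtain k where k: "?\<Phi> ^ k < \<eta>" "0 < k"
    by (auto dest: eventually_happens)
  define \<alpha> where "\<alpha> = \<epsilon> / real k"
  have \<alpha>: "0 < \<alpha>" using \<epsilon> k by (simp add: \<alpha>_def)
  define r where "r n = nat \<lfloor>\<alpha> * real n\<rfloor>" for n :: nat
  have r_le: "real (r n) \<le> \<alpha> * real n" and r_ge: "\<alpha> * real n - 1 \<le> real (r n)" for n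
    using \<alpha> unfolding r_def by (auto simp: of_nat_nat floor_le_iff)
  have "filterlim (\<lambda>n. \<alpha> * real n - 1) at_top sequentially"
    using \<alpha> by real_asymp
  then have "filterlim (\<lambda>n. real (r n)) at_top sequentially"
    by (rule filterlim_at_top_mono) (simp add: r_ge)
  then have r_lim: "filterlim r at_top sequentially"
    by (simp add: filterlim_real_sequentially filterlim_sequentially_iff_filterlim_real)
  let ?b = "\<lambda>n. ?q (r n) ^ k + (real n + 1)\<^sup>2 * (exp (- sqrt (real (r n) * \<sigma>\<^sup>2)) / \<delta>)"
  have "(\<lambda>n. (real n + 1)\<^sup>2 * (exp (- sqrt (real (r n) * \<sigma>\<^sup>2)) / \<delta>)) \<longlonglongrightarrow> 0"
  proof (rule tendsto_sandwich[of "\<lambda>_. 0"])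
    have "\<forall>n. (real n + 1)\<^sup>2 * (exp (- sqrt (real (r n) * \<sigma>\<^sup>2)) / \<delta>) \<le>
        (real n + 1)\<^sup>2 * (exp (- sqrt ((\<alpha> * real n - 1) * \<sigma>\<^sup>2)) / \<delta>)"
      using r_ge \<delta> by (auto intro!: mult_left_mono divide_right_mono mult_right_mono)
    then show "\<forall>\<^sub>F n in sequentially. (real n + 1)\<^sup>2 * (exp (- sqrt (real (r n) * \<sigma>\<^sup>2)) / \<delta>) \<le>
        (real n + 1)\<^sup>2 * (exp (- sqrt ((\<alpha> * real n - 1) * \<sigma>\<^sup>2)) / \<delta>)"
      by simp
    show "(\<lambda>n. (real n + 1)\<^sup>2 * (exp (- sqrt ((\<alpha> * real n - 1) * \<sigma>\<^sup>2)) / \<delta>)) \<longlonglongrightarrow> 0"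
      using \<alpha> \<sigma> \<delta> by real_asymp
  qed (use \<delta> in auto)
  moreover have "(\<lambda>n. ?q (r n) ^ k) \<longlonglongrightarrow> ?\<Phi> ^ k"
    by (intro tendsto_power filterlim_compose[OF q r_lim])
  ultimately have "?b \<longlonglongrightarrow> ?\<Phi> ^ k + 0" by (intro tendsto_add)
  then have "\<forall>\<^sub>F n in sequentially. ?b n < \<eta>"
    using k(1) by (intro order_tendstoD) auto
  then show "\<forall>\<^sub>F n in sequentially. ?a n < \<eta>"
  proof eventually_elim
    case (elim n)
    interpret A: prob_space "annealed P" by (rule prob_space_annealed[OF prob_space_axioms sets_P])
    have G: "{X. \<epsilon> * real n < real (X n)} \<in> sets path_space"
    proof -
      have "{X \<in> space path_space. \<epsilon> * real n < real (X n)} \<in> sets path_space" by measurable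
      then show ?thesis by simp
    qed
    have kr: "real (k * r n) \<le> \<epsilon> * real n"
      using mult_left_mono[OF r_le[of n], of "real k"] k(2) by (simp add: \<alpha>_def)
    have "ennreal (?a n) = emeasure (annealed P) {z \<in> space (annealed P). snd z \<in> {X. \<epsilon> * real n < real (X n)}}"
      by (simp add: A.emeasure_eq_measure)
    also have "\<dots> = (\<integral>\<^sup>+\<omega>. emeasure (quenched \<omega>) {X. \<epsilon> * real n < real (X n)} \<partial>P)"
      by (rule emeasure_annealed_path_event[OF G])
    also have "\<dots> \<le> (\<integral>\<^sup>+\<omega>. emeasure (quenched \<omega>) {X. k * r n < X n} \<partial>P)"
    proof (intro nn_integral_mono emeasure_mono subsetI CollectI)
      fix X assume "X \<in> {X. \<epsilon> * real n < real (X n)}"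
      then have "real (k * r n) < real (X n)" using kr by (simp only: mem_Collect_eq)
      then show "k * r n < X n" by (simp only: of_nat_less_iff)
    next
      fix \<omega>
      have "{X \<in> space path_space. k * r n < X n} \<in> sets path_space" by measurable
      then show "{X. k * r n < X n} \<in> sets (quenched \<omega>)" by (simp add: quenched_def)
    qed
    also have "\<dots> \<le> ennreal (?b n)"
      by (rule annealed_exceed_le[OF sites \<delta> k(2)]) simp
    finally have "?a n \<le> ?b n" using \<delta> by (subst (asm) ennreal_le_iff) auto
    with elim show ?case by linarith
  qed
qed (auto intro!: always_eventually intro: less_le_trans[OF _ measure_nonneg])

end

section \<open>Averages over the increments\<close>

lemma sum_increments: "(\<Sum>k = 1..n. increment X k) = int (X (Suc n)) - int (X 1)"
  by (induction n) (auto simp: increment_def)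

text \<open>
  On \<open>{-1, 1}\<close> every function agrees with an affine one, so its sum along a path of unit steps is determined by the
  number of steps and the endpoints.
\<close>

lemma sum_fun_increments:
  fixes f :: "int \<Rightarrow> real"
  assumes "\<And>k. \<bar>increment X k\<bar> = 1"
  shows "(\<Sum>k = 1..n. f (increment X k)) = 
    real n * ((f 1 + f (-1)) / 2) + (f 1 - f (-1)) / 2 * (real (X (Suc n)) - real (X 1))"
proof -
  have "f (increment X k) = (f 1 + f (-1)) / 2 + (f 1 - f (-1)) / 2 * of_int (increment X k)" for k
    using assms[of k] by (auto simp: abs_eq_iff' field_simps)
  then have "(\<Sum>k = 1..n. f (increment X k)) =
      real n * ((f 1 + f (-1)) / 2) + (f 1 - f (-1)) / 2 * of_int (\<Sum>k = 1..n. increment X k)"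
    by (simp add: sum.distrib sum_distrib_left)
  then show ?thesis unfolding sum_increments by simp
qed

theorem proposition2p1:
  fixes P :: "env measure" and \<delta>\<^sub>0 h :: real and f :: "int \<Rightarrow> real"
  assumes iid: "iid_env P"
    and A1: "prob_space.expectation P (\<lambda>\<omega>. ln (rho \<omega> 0)) = 0"
    and A2: "0 < \<delta>\<^sub>0" "\<delta>\<^sub>0 < 1"
      "measure P {\<omega> \<in> space P. \<delta>\<^sub>0 \<le> \<omega> 0 \<and> \<omega> 0 \<le> 1 - \<delta>\<^sub>0} = 1"
      "prob_space.variance P (\<lambda>\<omega>. ln (rho \<omega> 0)) > 0"
    and A3: "h > 0" "AE \<omega> in P. \<exists>k::int. ln (rho \<omega> 0) = of_int k * h"
  shows "tendsto_in_prob (annealed P)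
           (\<lambda>n (\<omega>, X). (\<Sum>k = 1..n. f (increment X k)) / real n) ((f 1 + f (-1)) / 2)
       \<and> tendsto_in_prob (annealed P) (\<lambda>n (\<omega>, X). real (X n) / real n) 0"
proof -
  interpret iid_environment P by unfold_locales (rule iid)
  interpret A: prob_space "annealed P" by (rule prob_space_annealed[OF prob_space_axioms sets_P])
  have sets_A [measurable_cong]: "sets (annealed P) = sets (env_space \<Otimes>\<^sub>M path_space)"
    by (rule sets_annealed[OF prob_space_axioms sets_P])
  have "AE \<omega> in P. \<omega> 0 \<in> {\<delta>\<^sub>0..1 - \<delta>\<^sub>0}"
    using AE_prob_1[OF A2(3)] by eventually_elim auto
  from AE_all_sites[OF this] have sites: "AE \<omega> in P. \<forall>x. \<delta>\<^sub>0 \<le> \<omega> x \<and> \<omega> x \<le> 1 - \<delta>\<^sub>0"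
    by simp
  have zero: "(\<lambda>n. A.prob {z \<in> space (annealed P). \<epsilon> * real n < real (snd z n)}) \<longlonglongrightarrow> 0"
    if "0 < \<epsilon>" for \<epsilon>
    using A1 A2 that by (intro annealed_speed_zero[OF sites]) simp_all
  have "snd \<in> annealed P \<rightarrow>\<^sub>M path_space"
    by (simp add: measurable_cong_sets[OF sets_A refl])
  then have coord: "(\<lambda>z. g (snd z k)) \<in> annealed P \<rightarrow>\<^sub>M N" if "g \<in> count_space UNIV \<rightarrow>\<^sub>M N"
    for g and N :: "'b measure" and k
    using measurable_compose[OF measurable_compose[OF _ measurable_path_coord] that] by blast
  have real_coord [measurable]: "(\<lambda>z. real (snd z k)) \<in> borel_measurable (annealed P)" for k
    by (rule coord) simp
  have pair: "(\<lambda>z. (snd z (Suc k), snd z k)) \<in> annealed P \<rightarrow>\<^sub>M count_space UNIV \<Otimes>\<^sub>M count_space UNIV" for k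
    using coord[of "\<lambda>n. n"] by (intro measurable_Pair) simp_all
  have incr [measurable]: "(\<lambda>z. f (increment (snd z) k)) \<in> borel_measurable (annealed P)" for k
    using measurable_compose[OF pair, of "\<lambda>(a, b). f (int a - int b)"]
    by (simp add: increment_def pair_measure_countable)
  have speed: "tendsto_in_prob (annealed P) (\<lambda>n (\<omega>, X). real (X n) / real n) 0"
    unfolding tendsto_in_prob_def case_prod_beta
  proof (intro conjI allI impI)
    show "(\<lambda>z. real (snd z n) / real n) \<in> borel_measurable (annealed P)" for n by measurable
    fix \<epsilon> :: real assume "0 < \<epsilon>"
    have "\<forall>\<^sub>F n in sequentially. A.prob {z \<in> space (annealed P). \<epsilon> * real n < real (snd z n)} =
        A.prob {z \<in> space (annealed P). \<epsilon> < \<bar>real (snd z n) / real n - 0\<bar>}"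
      using eventually_gt_at_top[of 0] by eventually_elim (simp add: pos_less_divide_eq)
    then show "(\<lambda>n. A.prob {z \<in> space (annealed P). \<epsilon> < \<bar>real (snd z n) / real n - 0\<bar>}) \<longlonglongrightarrow> 0"
      by (rule Lim_transform_eventually[OF zero[OF \<open>0 < \<epsilon>\<close>]])
  qed
  let ?c = "(f 1 + f (-1)) / 2" and ?d = "\<bar>f 1 - f (-1)\<bar> / 2 + 1"
  have d: "0 < ?d" by (rule add_nonneg_pos) simp_all
  have "tendsto_in_prob (annealed P) (\<lambda>n (\<omega>, X). (\<Sum>k = 1..n. f (increment X k)) / real n) ?c"
    unfolding tendsto_in_prob_def case_prod_beta
  proof (intro conjI allI impI)
    show meas: "(\<lambda>z. (\<Sum>k = 1..n. f (increment (snd z) k)) / real n) \<in> borel_measurable (annealed P)" for n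
      by measurable
    fix \<epsilon> :: real assume \<epsilon>: "0 < \<epsilon>"
    \<comment> \<open>The factor \<open>2\<close> leaves room for the bounded error between \<open>X (n + 1) - X 1\<close> and \<open>X n\<close>;
      the summand \<open>1\<close> in \<open>?d\<close> only ensures that it is positive.\<close>
    define \<kappa> where "\<kappa> = \<epsilon> / (2 * ?d)"
    have \<kappa>: "0 < \<kappa>" using \<epsilon> d by (simp add: \<kappa>_def)
    let ?Y = "\<lambda>n z. (\<Sum>k = 1..n. f (increment (snd z) k)) / real n - ?c"
    have "\<forall>\<^sub>F n :: nat in sequentially. 2 / \<kappa> < real n" by real_asymp
    then have "\<forall>\<^sub>F n in sequentially. A.prob {z \<in> space (annealed P). \<epsilon> < \<bar>?Y n z\<bar>} \<le>
        A.prob {z \<in> space (annealed P). \<kappa> * real n < real (snd z n)}"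
      using eventually_gt_at_top[of 0]
    proof eventually_elim
      case (elim n)
      show ?case
      proof (rule A.finite_measure_mono_AE)
        show "AE z in annealed P. z \<in> {z \<in> space (annealed P). \<epsilon> < \<bar>?Y n z\<bar>} \<longrightarrow>
            z \<in> {z \<in> space (annealed P). \<kappa> * real n < real (snd z n)}"
          using AE_annealed_nearest_neighbour
        proof eventually_elim
          case (elim z)
          have nn: "\<bar>increment (snd z) k\<bar> = 1" for k using elim by blast
          have "snd z 1 \<le> 1" using nn[of 0] elim by (simp add: increment_def)
          moreover have "snd z (Suc n) \<le> snd z n + 1"
            using nn[of n] unfolding increment_def by linarith
          ultimately have "\<bar>real (snd z (Suc n)) - real (snd z 1)\<bar> \<le> real (snd z n) + 1" by linarith
          moreover have "?Y n z * real n = (f 1 - f (-1)) / 2 * (real (snd z (Suc n)) - real (snd z 1))"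
            using \<open>0 < n\<close> unfolding sum_fun_increments[OF nn] left_diff_distrib by simp
          then have "\<bar>?Y n z\<bar> * real n = \<bar>f 1 - f (-1)\<bar> / 2 * \<bar>real (snd z (Suc n)) - real (snd z 1)\<bar>"
            using abs_mult[of "?Y n z" "real n"]
              abs_mult[of "(f 1 - f (-1)) / 2" "real (snd z (Suc n)) - real (snd z 1)"]
            by (simp only: abs_of_nat abs_divide abs_numeral)
          moreover have "\<bar>f 1 - f (-1)\<bar> / 2 * D \<le> ?d * (real (snd z n) + 1)"
            if "D \<le> real (snd z n) + 1" "0 \<le> D" for D
            using that d by (intro mult_mono) linarith+
          ultimately have *: "\<bar>?Y n z\<bar> * real n \<le> ?d * (real (snd z n) + 1)"
            by (simp only: abs_ge_zero)
          show ?case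
          proof (intro impI CollectI conjI)
            assume z: "z \<in> {z \<in> space (annealed P). \<epsilon> < \<bar>?Y n z\<bar>}"
            then show "z \<in> space (annealed P)" by simp
            have exceeds: "\<epsilon> * real n < \<bar>?Y n z\<bar> * real n" using z \<open>0 < n\<close> by simp
            have "D * (2 * (\<epsilon> / (2 * D)) * m) = \<epsilon> * m" if "0 < D" for D m :: real
              using that by (simp add: field_simps)
            from this[OF d] have "?d * (2 * \<kappa> * real n) = \<epsilon> * real n"
              unfolding \<kappa>_def .
            then have "?d * (2 * \<kappa> * real n) < ?d * (real (snd z n) + 1)"
              by (rule ord_eq_less_trans) (rule order.strict_trans2[OF exceeds *])
            then have "2 * \<kappa> * real n < real (snd z n) + 1"
              using d by (simp only: mult_less_cancel_left_pos)
            moreover have "2 < \<kappa> * real n"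
              using \<open>2 / \<kappa> < real n\<close> \<kappa> by (simp add: field_simps)
            ultimately show "\<kappa> * real n < real (snd z n)" by linarith
          qed
        qed
      qed measurable
    qed
    then show "(\<lambda>n. A.prob {z \<in> space (annealed P). \<epsilon> < \<bar>?Y n z\<bar>}) \<longlonglongrightarrow> 0"
      by (intro tendsto_sandwich[OF _ _ tendsto_const zero[OF \<kappa>]]) simp_all
  qed
  with speed show ?thesis by blast
qed

end
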